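(* For every Smullyan model $M$, the following two properties are equivalent: (FPT) every $M$-predicate has an $M$-fixed point; (F-Tarski$^+$) there is no $M$-predicate $H$ such that $\mathrm{False}_M^+ = \Phi_M(H)\cap \mathrm{Sent}_M^+$.
   Context: For a non-empty set $\Sigma$ of symbols, $\Sigma^\ast$ is the set of all finite strings over $\Sigma$, including the empty string $\epsilon$; $XY$ denotes concatenation. A Smullyan model is a triple $M=(\Sigma_M,\mathrm{Pred}_M,\Phi_M)$ where $\Sigma_M$ is a non-empty set of symbols, $\mathrm{Pred}_M\subseteq\Sigma_M^\ast$ is such that $HX\notin \mathrm{Pred}_M$ for all $H\in\mathrm{Pred}_M$ and $X\in\Sigma_M^\ast\setminus\{\epsilon\}$, and $\Phi_M:\mathrm{Pred}_M\to\mathcal{P}(\Sigma_M^\ast)$ is a function. Elements of $\mathrm{Pred}_M$ are called $M$-predicates. $\mathrm{Sent}_M=\{HX : H\in\mathrm{Pred}_M, X\in\Sigma_M^\ast\}$ is the set of $M$-sentences (the decomposition $HX$ of an $M$-sentence is unique), and $\mathrm{Sent}_M^+=\mathrm{Sent}_M\setminus\mathrm{Pred}_M$. $\mathrm{True}_M=\{HX\in \mathrm{Sent}_M : H\in\mathrm{Pred}_M, X\in\Phi_M(H)\}$, $\mathrm{True}_M^+=\mathrm{True}_M\cap\mathrm{Sent}_M^+$, and $\mathrm{False}_M^+=\mathrm{Sent}_M^+\setminus\mathrm{True}_M^+$. For an $M$-sentence $S$, write $M\models S$ if $S\in\mathrm{True}_M$. An $M$-fixed point of an $M$-predicate $H$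 is an $S\in\mathrm{Sent}_M^+$ such that $M\models S \iff M\models HS$. *)

theory Defs
  imports Main "HOL-Library.FuncSet"
begin

text \<open>
  Strings over an alphabet are lists, so \<open>lists \<Sigma>\<close> is the set of all finite strings over
  \<open>\<Sigma>\<close>, and concatenation is \<open>@\<close>.
\<close>

record 'a smullyan =
  Symb :: "'a set"
  Pred :: "'a list set"
  Phi :: "'a list \<Rightarrow> 'a list set"

text \<open>
  \<open>Phi M\<close> is a total HOL function representing a function with domain \<open>Pred M\<close>; its values
  outside \<open>Pred M\<close> are unconstrained and never used below.
\<close>

definition smullyan_model :: "'a smullyan \<Rightarrow> bool" where
  "smullyan_model M \<longleftrightarrow>
     Symb M \<noteq> {} \<and>
     Pred M \<subseteq> lists (Symb M) \<and>
     (\<forall>H\<in>Pred M. \<forall>X\<in>lists (Symb M) - {[]}. H @ X \<notin> Pred M) \<and>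
     Phi M \<in> Pred M \<rightarrow> Pow (lists (Symb M))"

definition Sent :: "'a smullyan \<Rightarrow> 'a list set" where
  "Sent M = {H @ X | H X. H \<in> Pred M \<and> X \<in> lists (Symb M)}"

definition Sent_plus :: "'a smullyan \<Rightarrow> 'a list set" where
  "Sent_plus M = Sent M - Pred M"

definition True_sent :: "'a smullyan \<Rightarrow> 'a list set" where
  "True_sent M = {H @ X | H X. H @ X \<in> Sent M \<and> H \<in> Pred M \<and> X \<in> Phi M H}"

definition True_plus :: "'a smullyan \<Rightarrow> 'a list set" where
  "True_plus M = True_sent M \<inter> Sent_plus M"

definition False_plus :: "'a smullyan \<Rightarrow> 'a list set" where
  "False_plus M = Sent_plus M - True_plus M"

definition sat :: "'a smullyan \<Rightarrow> 'a list \<Rightarrow> bool" where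
  "sat M S \<longleftrightarrow> S \<in> True_sent M"

definition fixed_point :: "'a smullyan \<Rightarrow> 'a list \<Rightarrow> 'a list \<Rightarrow> bool" where
  "fixed_point M H S \<longleftrightarrow> S \<in> Sent_plus M \<and> (sat M S \<longleftrightarrow> sat M (H @ S))"

definition FPT :: "'a smullyan \<Rightarrow> bool" where
  "FPT M \<longleftrightarrow> (\<forall>H\<in>Pred M. \<exists>S. fixed_point M H S)"

definition F_Tarski_plus :: "'a smullyan \<Rightarrow> bool" where
  "F_Tarski_plus M \<longleftrightarrow> \<not> (\<exists>H\<in>Pred M. False_plus M = Phi M H \<inter> Sent_plus M)"

end

theory Submission
  imports Defs
begin

text \<open>Fix a predicate \<open>H\<close>. Since \<open>H @ S\<close> is true exactly when
  \<open>S\<close> lies in \<open>Phi M H\<close>, some \<open>S\<close> in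
  \<open>Sent_plus M\<close> fails to be a fixed point of \<open>H\<close> iff it is either false
  and in \<open>Phi M H\<close>, or true and outside it. So \<open>H\<close> has no fixed point iff
  \<open>Phi M H\<close> and \<open>False_plus M\<close> agree on \<open>Sent_plus M\<close>
  (\<open>no_fixed_point_iff\<close>); quantifying over \<open>H\<close> gives the
  equivalence.\<close>

text \<open>If two decompositions of a string differed, one predicate would be a proper prefix of
  the other.\<close>

lemma predicate_append_eq_iff:
  assumes "smullyan_model M" "H \<in> Pred M" "H' \<in> Pred M"
  shows "H @ X = H' @ X' \<longleftrightarrow> H = H' \<and> X = X'"
proof -
  \<comment> \<open>The model forbids only extensions by strings over \<open>Symb M\<close>. This
    covers every \<open>us\<close>, since a suffix of a predicate is itself over
    \<open>Symb M\<close>.\<close>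
  have no_extension: "K @ us \<notin> Pred M" if "K \<in> Pred M" "us \<noteq> []" for K us
  proof
    assume "K @ us \<in> Pred M"
    moreover from this have "us \<in> lists (Symb M)"
      using assms(1) by (auto simp: smullyan_model_def)
    ultimately show False
      using assms(1) that by (auto simp: smullyan_model_def)
  qed
  show ?thesis
    using assms(2,3) no_extension[of H] no_extension[of H']
    by (auto simp: append_eq_append_conv2)
qed

text \<open>By unique decomposition, no other predicate can make \<open>H @ X\<close> true.\<close>

lemma sat_predicate_append_iff:
  assumes "smullyan_model M" "H \<in> Pred M" "X \<in> lists (Symb M)"
  shows "sat M (H @ X) \<longleftrightarrow> X \<in> Phi M H"
proof -
  have "H @ X \<in> Sent M"
    using assms(2,3) unfolding Sent_def by blast
  then show ?thesis
    using assms(2) predicate_append_eq_iff[OF assms(1,2)]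
    unfolding sat_def True_sent_def by blast
qed

lemma Sent_plus_subset_lists:
  assumes "smullyan_model M"
  shows "Sent_plus M \<subseteq> lists (Symb M)"
  using assms unfolding smullyan_model_def Sent_plus_def Sent_def by fastforce

lemma no_fixed_point_iff:
  assumes "smullyan_model M" "H \<in> Pred M"
  shows "(\<nexists>S. fixed_point M H S) \<longleftrightarrow> False_plus M = Phi M H \<inter> Sent_plus M"
proof -
  \<comment> \<open>Within \<open>Sent_plus M\<close>, being true means lying outside
    \<open>False_plus M\<close>; thus a fixed point is a point where membership in
    \<open>False_plus M\<close> and in \<open>Phi M H\<close> differ.\<close>
  have "fixed_point M H S \<longleftrightarrow> S \<in> Sent_plus M \<and> (S \<notin> False_plus M \<longleftrightarrow> S \<in> Phi M H)" for S
    using sat_predicate_append_iff[OF assms, of S] Sent_plus_subset_lists[OF assms(1)]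
    by (auto simp: fixed_point_def False_plus_def True_plus_def sat_def)
  moreover have "False_plus M \<subseteq> Sent_plus M"
    by (auto simp: False_plus_def)
  ultimately show ?thesis
    by blast
qed

theorem proposition3p2:
  fixes M :: "'a smullyan"
  assumes "smullyan_model M"
  shows "FPT M \<longleftrightarrow> F_Tarski_plus M"
  using no_fixed_point_iff[OF assms] unfolding FPT_def F_Tarski_plus_def by blast

end
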